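(* Let $\mathcal{M}$ be a $K$-causal spacetime without boundary. Then the sets $A(p,q)$, $p,q\in\mathcal{M}$, furnish a basis for the manifold topology of $\mathcal{M}$; that is, they are open and every open subset of $\mathcal{M}$ is a union of sets of the form $A(p,q)$.
   Context: A spacetime is a smooth connected Hausdorff paracompact manifold $\mathcal{M}$ (of arbitrary dimension $\ge 2$) with a smooth time-oriented Lorentzian metric. $I^+(p)$ is the set of events accessible from $p$ by future-directed timelike curves starting from $p$, and $I^+$, regarded as a relation, is $\{(p,q): q\in I^+(p)\}\subseteq\mathcal{M}\times\mathcal{M}$; $I^-$ is defined analogously with future replaced by past. The relation $K^+$, also written $\prec$, is the smallest relation on $\mathcal{M}$ that contains $I^+$, is transitive, and is topologically closed as a subset of $\mathcal{M}\times\mathcal{M}$ (i.e. the intersection of all closed transitive relations containing $I^+$). $K^-$ is defined in the same way from $I^-$, and is the converse relation of $K^+$. $K^+(p)=\{q\in\mathcal{M}: p\prec q\}$ and $K^-(q)=\{p\in\mathcal{M}: p\prec q\}$. The spacetime $\mathcal{M}$ is $K$-causal iff $\prec$ is a (reflexive) partial order on $\mathcal{M}$, i.e. $\prec$ is antisymmetric. The causal (order-theoretic) boundary $\partial K^+(p)$ is the set of all $x\in K^+(p)$ for which there is an increasing sequence $y_1\prec y_2\prec y_3\prec\cdots$ of points, all belonging to the complement of $K^+(p)$, such that $x=\sup\{y_i\}$, the supremum (least upper bound) being taken in $\mathcal{M}$ with respect to $\prec$. Dually, $\partial K^-(q)$ is the set of all $x\in K^-(q)$ that are the infimum with respect to $\prec$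 of a decreasing sequence of points all belonging to the complement of $K^-(q)$. One sets $A^+(p)=K^+(p)\setminus\partial K^+(p)$, $A^-(q)=K^-(q)\setminus\partial K^-(q)$, and $A(p,q)=A^+(p)\cap A^-(q)$. *)

theory Defs
  imports "HOL-Analysis.Analysis"
begin

section \<open>Smooth maps between Euclidean spaces\<close>

text \<open>Used on open sets \<open>S\<close> only. For \<open>n \<ge> 1\<close> every directional derivative
  is required to be \<open>n - 1\<close> times continuously differentiable.\<close>

fun times_cont_diff_on ::
    "nat \<Rightarrow> 'a::euclidean_space set \<Rightarrow> ('a \<Rightarrow> 'b::real_normed_vector) \<Rightarrow> bool" where
  "times_cont_diff_on 0 S f \<longleftrightarrow> continuous_on S f"
| "times_cont_diff_on (Suc n) S f \<longleftrightarrow>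
     (\<forall>x\<in>S. f differentiable (at x)) \<and>
     (\<forall>v. times_cont_diff_on n S (\<lambda>x. frechet_derivative f (at x) v))"

definition smooth_map_on ::
    "'a::euclidean_space set \<Rightarrow> ('a \<Rightarrow> 'b::real_normed_vector) \<Rightarrow> bool" where
  "smooth_map_on S f \<longleftrightarrow> (\<forall>n. times_cont_diff_on n S f)"


section \<open>Smooth manifolds\<close>

definition paracompact_space :: "'a topology \<Rightarrow> bool" where
  "paracompact_space X \<longleftrightarrow>
     (\<forall>\<U>. (\<forall>U\<in>\<U>. openin X U) \<and> \<Union>\<U> = topspace X \<longrightarrow>
       (\<exists>\<V>. (\<forall>V\<in>\<V>. openin X V) \<and> \<Union>\<V> = topspace X \<and>
            (\<forall>V\<in>\<V>. \<exists>U\<in>\<U>. V \<subseteq> U) \<and> locally_finite_in X \<V>))"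

type_synonym ('a, 'e) chart = "'a set \<times> ('a \<Rightarrow> 'e)"

abbreviation chart_dom :: "('a, 'e) chart \<Rightarrow> 'a set" where
  "chart_dom c \<equiv> fst c"

abbreviation chart_map :: "('a, 'e) chart \<Rightarrow> 'a \<Rightarrow> 'e" where
  "chart_map c \<equiv> snd c"

definition chart_inv :: "('a, 'e) chart \<Rightarrow> 'e \<Rightarrow> 'a" where
  "chart_inv c = inv_into (chart_dom c) (chart_map c)"

definition transition :: "('a, 'e) chart \<Rightarrow> ('a, 'e) chart \<Rightarrow> 'e \<Rightarrow> 'e" where
  "transition c d = chart_map d \<circ> chart_inv c"

text \<open>Charts are onto open subsets of the whole space \<open>'e\<close>, so there is no manifold boundary.\<close>

definition is_chart :: "'a topology \<Rightarrow> ('a, 'e::euclidean_space) chart \<Rightarrow> bool" where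
  "is_chart X c \<longleftrightarrow>
     openin X (chart_dom c) \<and> open (chart_map c ` chart_dom c) \<and>
     homeomorphic_map (subtopology X (chart_dom c)) (top_of_set (chart_map c ` chart_dom c))
       (chart_map c)"

definition smooth_atlas :: "'a topology \<Rightarrow> ('a, 'e::euclidean_space) chart set \<Rightarrow> bool" where
  "smooth_atlas X \<A> \<longleftrightarrow>
     (\<forall>c\<in>\<A>. is_chart X c) \<and> (\<Union>c\<in>\<A>. chart_dom c) = topspace X \<and>
     (\<forall>c\<in>\<A>. \<forall>d\<in>\<A>. smooth_map_on (chart_map c ` (chart_dom c \<inter> chart_dom d)) (transition c d))"

text \<open>The smooth structure is the one generated by the atlas, which need not be maximal.\<close>

definition smooth_manifold :: "'a topology \<Rightarrow> ('a, 'e::euclidean_space) chart set \<Rightarrow> bool" where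
  "smooth_manifold X \<A> \<longleftrightarrow>
     connected_space X \<and> Hausdorff_space X \<and> paracompact_space X \<and> smooth_atlas X \<A>"


section \<open>Spacetimes\<close>

text \<open>A tensor field is given by its representatives in the charts of the atlas:
  \<open>g c p\<close> is the bilinear form at \<open>p\<close> and \<open>T c p\<close> the tangent vector at \<open>p\<close>, both
  expressed in the coordinates of the chart \<open>c\<close>. They are constrained only for charts \<open>c\<close> of the
  atlas and points \<open>p\<close> of the domain of \<open>c\<close>, where they obey the usual covariant, respectively
  contravariant, transformation law.\<close>

type_synonym ('a, 'e) form_field = "('a, 'e) chart \<Rightarrow> 'a \<Rightarrow> 'e \<Rightarrow> 'e \<Rightarrow> real"
type_synonym ('a, 'e) vector_field = "('a, 'e) chart \<Rightarrow> 'a \<Rightarrow> 'e"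

text \<open>Signature \<open>(-,+,\<dots>,+)\<close>: \<open>f\<close> maps the standard basis to a pseudo-orthonormal
  basis with exactly one timelike member.\<close>

definition lorentz_form :: "('e::euclidean_space \<Rightarrow> 'e \<Rightarrow> real) \<Rightarrow> bool" where
  "lorentz_form B \<longleftrightarrow>
     bilinear B \<and> (\<forall>v w. B v w = B w v) \<and>
     (\<exists>f :: 'e \<Rightarrow> 'e. linear f \<and> bij f \<and>
       (\<exists>k\<in>Basis. \<forall>i\<in>Basis. \<forall>j\<in>Basis.
          B (f i) (f j) = (if i \<noteq> j then 0 else if i = k then - 1 else 1)))"

definition lorentz_metric ::
    "('a, 'e::euclidean_space) chart set \<Rightarrow> ('a, 'e) form_field \<Rightarrow> bool" where
  "lorentz_metric \<A> g \<longleftrightarrow>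
     (\<forall>c\<in>\<A>. \<forall>p\<in>chart_dom c. lorentz_form (g c p)) \<and>
     (\<forall>c\<in>\<A>. \<forall>v w. smooth_map_on (chart_map c ` chart_dom c) (\<lambda>x. g c (chart_inv c x) v w)) \<and>
     (\<forall>c\<in>\<A>. \<forall>d\<in>\<A>. \<forall>p\<in>chart_dom c \<inter> chart_dom d. \<forall>v w.
        let D = frechet_derivative (transition c d) (at (chart_map c p))
        in g c p v w = g d p (D v) (D w))"

text \<open>A time orientation is given by a globally defined continuous timelike vector field.\<close>

definition time_orientation ::
    "('a, 'e::euclidean_space) chart set \<Rightarrow> ('a, 'e) form_field \<Rightarrow> ('a, 'e) vector_field \<Rightarrow> bool" where
  "time_orientation \<A> g T \<longleftrightarrow>
     (\<forall>c\<in>\<A>. continuous_on (chart_map c ` chart_dom c) (\<lambda>x. T c (chart_inv c x))) \<and>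
     (\<forall>c\<in>\<A>. \<forall>d\<in>\<A>. \<forall>p\<in>chart_dom c \<inter> chart_dom d.
        T d p = frechet_derivative (transition c d) (at (chart_map c p)) (T c p)) \<and>
     (\<forall>c\<in>\<A>. \<forall>p\<in>chart_dom c. g c p (T c p) (T c p) < 0)"

record ('a, 'e) spacetime_data =
  space_top :: "'a topology"
  atlas :: "('a, 'e) chart set"
  metric :: "('a, 'e) form_field"
  time_field :: "('a, 'e) vector_field"

definition events :: "('a, 'e) spacetime_data \<Rightarrow> 'a set" where
  "events M = topspace (space_top M)"

definition spacetime :: "('a, 'e::euclidean_space) spacetime_data \<Rightarrow> bool" where
  "spacetime M \<longleftrightarrow>
     DIM('e) \<ge> 2 \<and> smooth_manifold (space_top M) (atlas M) \<and>
     lorentz_metric (atlas M) (metric M) \<and> time_orientation (atlas M) (metric M) (time_field M)"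


section \<open>Chronological relation\<close>

definition future_timelike ::
    "('a, 'e) spacetime_data \<Rightarrow> ('a, 'e) chart \<Rightarrow> 'a \<Rightarrow> 'e \<Rightarrow> bool" where
  "future_timelike M c p v \<longleftrightarrow>
     metric M c p v v < 0 \<and> metric M c p v (time_field M c p) < 0"

text \<open>\<open>C\<^sup>1\<close> arc on \<open>[a,b]\<close>, with one-sided tangent vectors at the end points.\<close>

definition C1_timelike_arc ::
    "('a, 'e::euclidean_space) spacetime_data \<Rightarrow> real \<Rightarrow> real \<Rightarrow> (real \<Rightarrow> 'a) \<Rightarrow> bool" where
  "C1_timelike_arc M a b \<gamma> \<longleftrightarrow>
     (\<forall>c\<in>atlas M. \<exists>\<gamma>'.
        continuous_on {t\<in>{a..b}. \<gamma> t \<in> chart_dom c} \<gamma>' \<and>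
        (\<forall>t\<in>{a..b}. \<gamma> t \<in> chart_dom c \<longrightarrow>
           ((\<lambda>s. chart_map c (\<gamma> s)) has_vector_derivative \<gamma>' t) (at t within {a..b}) \<and>
           future_timelike M c (\<gamma> t) (\<gamma>' t)))"

text \<open>Future-directed timelike curves are continuous and piecewise \<open>C\<^sup>1\<close>, with break points
  in the finite set \<open>S\<close>; at a break point both one-sided tangents are future-directed timelike.\<close>

definition timelike_curve ::
    "('a, 'e::euclidean_space) spacetime_data \<Rightarrow> (real \<Rightarrow> 'a) \<Rightarrow> bool" where
  "timelike_curve M \<gamma> \<longleftrightarrow>
     continuous_map (top_of_set {0..1}) (space_top M) \<gamma> \<and>
     (\<exists>S. finite S \<and>
        (\<forall>a b. 0 \<le> a \<and> a < b \<and> b \<le> 1 \<and> S \<inter> {a<..<b} = {} \<longrightarrow> C1_timelike_arc M a b \<gamma>))"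

definition I_plus :: "('a, 'e::euclidean_space) spacetime_data \<Rightarrow> ('a \<times> 'a) set" where
  "I_plus M = {(p, q). \<exists>\<gamma>. timelike_curve M \<gamma> \<and> \<gamma> 0 = p \<and> \<gamma> 1 = q}"


section \<open>The relation \<open>K\<^sup>+\<close> and its order-theoretic boundaries\<close>

definition K_plus :: "('a, 'e::euclidean_space) spacetime_data \<Rightarrow> ('a \<times> 'a) set" where
  "K_plus M =
     \<Inter>{R. I_plus M \<subseteq> R \<and> trans R \<and> closedin (prod_topology (space_top M) (space_top M)) R}"

definition K_causal :: "('a, 'e::euclidean_space) spacetime_data \<Rightarrow> bool" where
  "K_causal M \<longleftrightarrow> partial_order_on (events M) (K_plus M)"

definition is_supremum :: "('a \<times> 'a) set \<Rightarrow> 'a set \<Rightarrow> 'a set \<Rightarrow> 'a \<Rightarrow> bool" where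
  "is_supremum R E Y x \<longleftrightarrow>
     x \<in> E \<and> (\<forall>y\<in>Y. (y, x) \<in> R) \<and> (\<forall>z\<in>E. (\<forall>y\<in>Y. (y, z) \<in> R) \<longrightarrow> (x, z) \<in> R)"

definition is_infimum :: "('a \<times> 'a) set \<Rightarrow> 'a set \<Rightarrow> 'a set \<Rightarrow> 'a \<Rightarrow> bool" where
  "is_infimum R E Y x \<longleftrightarrow>
     x \<in> E \<and> (\<forall>y\<in>Y. (x, y) \<in> R) \<and> (\<forall>z\<in>E. (\<forall>y\<in>Y. (z, y) \<in> R) \<longrightarrow> (z, x) \<in> R)"

definition K_fut :: "('a, 'e::euclidean_space) spacetime_data \<Rightarrow> 'a \<Rightarrow> 'a set" where
  "K_fut M p = {q \<in> events M. (p, q) \<in> K_plus M}"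

definition K_past :: "('a, 'e::euclidean_space) spacetime_data \<Rightarrow> 'a \<Rightarrow> 'a set" where
  "K_past M q = {p \<in> events M. (p, q) \<in> K_plus M}"

definition bd_K_fut :: "('a, 'e::euclidean_space) spacetime_data \<Rightarrow> 'a \<Rightarrow> 'a set" where
  "bd_K_fut M p =
     {x \<in> K_fut M p. \<exists>y :: nat \<Rightarrow> 'a.
        (\<forall>i. y i \<in> events M - K_fut M p) \<and> (\<forall>i. (y i, y (Suc i)) \<in> K_plus M) \<and>
        is_supremum (K_plus M) (events M) (range y) x}"

definition bd_K_past :: "('a, 'e::euclidean_space) spacetime_data \<Rightarrow> 'a \<Rightarrow> 'a set" where
  "bd_K_past M q =
     {x \<in> K_past M q. \<exists>y :: nat \<Rightarrow> 'a.
        (\<forall>i. y i \<in> events M - K_past M q) \<and> (\<forall>i. (y (Suc i), y i) \<in> K_plus M) \<and>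
        is_infimum (K_plus M) (events M) (range y) x}"

definition A_fut :: "('a, 'e::euclidean_space) spacetime_data \<Rightarrow> 'a \<Rightarrow> 'a set" where
  "A_fut M p = K_fut M p - bd_K_fut M p"

definition A_past :: "('a, 'e::euclidean_space) spacetime_data \<Rightarrow> 'a \<Rightarrow> 'a set" where
  "A_past M q = K_past M q - bd_K_past M q"

definition A_set :: "('a, 'e::euclidean_space) spacetime_data \<Rightarrow> 'a \<Rightarrow> 'a \<Rightarrow> 'a set" where
  "A_set M p q = A_fut M p \<inter> A_past M q"

end

theory Submission
  imports Defs
begin

text \<open>The relation \<open>K\<^sup>+\<close> interpolates: a pair \<open>a \<prec> b\<close> separated by a compact set \<open>B\<close> has an
  intermediate point \<open>w \<in> B\<close>, because the pairs with this property form, together with the pairs not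
  separated by \<open>B\<close>, a closed transitive relation containing \<open>I\<^sup>+\<close>. With compactness and
  antisymmetry this confines monotone sequences and small order intervals to compact
  neighbourhoods. Hence the order-theoretic boundary of \<open>K\<^sup>+(p)\<close> is its topological boundary,
  \<open>A\<^sup>+(p)\<close> is the interior of \<open>K\<^sup>+(p)\<close>, and the sets \<open>A(p,q)\<close> with \<open>p\<close>, \<open>q\<close> close to \<open>x\<close> on a
  timelike curve through \<open>x\<close> shrink to \<open>x\<close>.\<close>

section \<open>Closed interpolating orders\<close>

text \<open>For an arbitrary relation, so that the past boundary is the same notion applied to
  \<open>K\<inverse>\<close>: an infimum for \<open>R\<close> is a supremum for the converse of
  \<open>R\<close>.\<close>

definition future_bd :: "'a set \<Rightarrow> ('a \<times> 'a) set \<Rightarrow> 'a \<Rightarrow> 'a set" where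
  "future_bd E R p =
     {x \<in> R `` {p}. \<exists>y :: nat \<Rightarrow> 'a.
        (\<forall>i. y i \<in> E - R `` {p}) \<and> (\<forall>i. (y i, y (Suc i)) \<in> R) \<and> is_supremum R E (range y) x}"

text \<open>In \<open>interpolation\<close> the complements of \<open>C\<close> and \<open>D\<close>
  are disjoint open sets around \<open>a\<close> and \<open>b\<close>, and
  \<open>C \<inter> D\<close> is the compact barrier between them. The two approximation axioms
  stand in for the timelike curve through \<open>x\<close>. The axioms as a whole are invariant
  under reversal of \<open>K\<close>, so each result about futures has a twin about pasts.\<close>

locale closed_interpolating_order =
  fixes X :: "'a topology" and K :: "('a \<times> 'a) set"
  assumes Hausdorff: "Hausdorff_space X"
    and locally_compact: "locally_compact_space X"
    and closed: "closedin (prod_topology X X) K"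
    and partial_order: "partial_order_on (topspace X) K"
    and interpolation: "\<lbrakk>(a, b) \<in> K; closedin X C; closedin X D; C \<union> D = topspace X;
          compactin X (C \<inter> D); a \<notin> C; b \<notin> D\<rbrakk> \<Longrightarrow> \<exists>w\<in>C \<inter> D. (a, w) \<in> K \<and> (w, b) \<in> K"
    and approx_below: "x \<in> topspace X \<Longrightarrow>
          \<exists>y. limitin X y x sequentially \<and> (\<forall>n. (y n, y (Suc n)) \<in> K) \<and>
              (\<forall>n. x \<in> X interior_of (K `` {y n}))"
    and approx_above: "x \<in> topspace X \<Longrightarrow>
          \<exists>y. limitin X y x sequentially \<and> (\<forall>n. (y (Suc n), y n) \<in> K) \<and>
              (\<forall>n. x \<in> X interior_of (K\<inverse> `` {y n}))"
begin

lemma K_subset: "K \<subseteq> topspace X \<times> topspace X"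
  using closedin_subset[OF closed] by simp

lemma K_refl: "x \<in> topspace X \<Longrightarrow> (x, x) \<in> K"
  using partial_order by (auto simp: order_on_defs refl_on_def)

lemma K_trans: "(x, y) \<in> K \<Longrightarrow> (y, z) \<in> K \<Longrightarrow> (x, z) \<in> K"
  using partial_order by (auto simp: order_on_defs dest: transD)

lemma K_antisym: "(x, y) \<in> K \<Longrightarrow> (y, x) \<in> K \<Longrightarrow> x = y"
  using partial_order by (auto simp: order_on_defs dest: antisymD)

lemma closedin_converse: "closedin (prod_topology X X) (K\<inverse>)"
proof -
  have "continuous_map (prod_topology X X) (prod_topology X X) (\<lambda>z. (snd z, fst z))"
    by (intro continuous_map_pairedI continuous_map_fst continuous_map_snd)
  from closedin_continuous_map_preimage[OF this closed]
  have "closedin (prod_topology X X)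
          {z \<in> topspace (prod_topology X X). (snd z, fst z) \<in> K}" .
  also have "{z \<in> topspace (prod_topology X X). (snd z, fst z) \<in> K} = K\<inverse>"
    using K_subset by auto
  finally show ?thesis .
qed

text \<open>Reversal exchanges the end points \<open>a\<close> and \<open>b\<close>, hence the roles
  of \<open>C\<close> and \<open>D\<close>, and it exchanges \<open>approx_below\<close> with
  \<open>approx_above\<close>.\<close>

lemma dual: "closed_interpolating_order X (K\<inverse>)"
proof
  show "partial_order_on (topspace X) (K\<inverse>)"
    using partial_order by simp
  show "\<exists>w\<in>C \<inter> D. (a, w) \<in> K\<inverse> \<and> (w, b) \<in> K\<inverse>"
    if "(a, b) \<in> K\<inverse>" "closedin X C" "closedin X D" "C \<union> D = topspace X"
      "compactin X (C \<inter> D)" "a \<notin> C" "b \<notin> D" for a b C D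
    using interpolation[of b a D C] that by (auto simp: Un_commute Int_commute)
qed (use Hausdorff locally_compact closedin_converse approx_below approx_above in auto)

lemma closedin_future: "closedin X (K `` {p})"
proof (cases "p \<in> topspace X")
  case True
  then have "continuous_map X (prod_topology X X) (\<lambda>z. (p, z))"
    by (intro continuous_map_pairedI) auto
  from closedin_continuous_map_preimage[OF this closed]
  have "closedin X {z \<in> topspace X. (p, z) \<in> K}" .
  also have "{z \<in> topspace X. (p, z) \<in> K} = K `` {p}"
    using K_subset by auto
  finally show ?thesis .
next
  case False
  then have "K `` {p} = {}" using K_subset by auto
  then show ?thesis by simp
qed

lemma closedin_past: "closedin X (K\<inverse> `` {p})"
  by (rule closed_interpolating_order.closedin_future[OF dual])

lemma increasing_sequence: "(y i, y j) \<in> K"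
  if "\<And>n. (y n, y (Suc n)) \<in> K" "i \<le> j" for y :: "nat \<Rightarrow> 'a"
  using that(2)
proof (induction rule: dec_induct)
  case base
  then show ?case using that(1) K_subset K_refl by blast
next
  case (step n)
  then show ?case using that(1) K_trans by blast
qed

lemma decreasing_sequence: "(y j, y i) \<in> K"
  if "\<And>n. (y (Suc n), y n) \<in> K" "i \<le> j" for y :: "nat \<Rightarrow> 'a"
  using closed_interpolating_order.increasing_sequence[OF dual, of y i j] that by auto

text \<open>Cantor's intersection theorem: the traces of the order intervals on \<open>B\<close> are
  closed because \<open>K\<close> is, and decreasing by transitivity. Nothing is assumed about
  convergence of \<open>p\<close> or \<open>q\<close>.\<close>

lemma compact_nested_intervals:
  fixes p q :: "nat \<Rightarrow> 'a"
  assumes "compactin X B"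
    and "\<And>n. (p n, p (Suc n)) \<in> K" and "\<And>n. (q (Suc n), q n) \<in> K"
    and ne: "\<And>n. \<exists>w\<in>B. (p n, w) \<in> K \<and> (w, q n) \<in> K"
  shows "\<exists>w\<in>B. \<forall>n. (p n, w) \<in> K \<and> (w, q n) \<in> K"
proof -
  define F where "F n = B \<inter> (K `` {p n} \<inter> K\<inverse> `` {q n})" for n
  have "compact_space (subtopology X B)"
    using assms(1) compactin_subspace by blast
  moreover have "closedin (subtopology X B) (F n)" for n
    unfolding F_def
    by (intro closedin_subtopology_Int_closed closedin_Int closedin_future closedin_past)
  moreover have "F n \<noteq> {}" for n
    using ne[of n] by (auto simp: F_def)
  moreover have "decseq F"
    unfolding F_def by (intro decseq_SucI) (use assms(2,3) K_trans in blast)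
  ultimately have "(\<Inter>n. F n) \<noteq> {}"
    by (rule compact_space_imp_nest)
  then show ?thesis
    by (auto simp: F_def)
qed

lemma limit_le:
  assumes "limitin X y x sequentially" "\<And>n. (y n, z) \<in> K"
  shows "(x, z) \<in> K"
  using limitin_closedin[OF assms(1) closedin_past[of z]] assms(2) by auto

lemma le_limit:
  assumes "limitin X y x sequentially" "\<And>n. (z, y n) \<in> K"
  shows "(z, x) \<in> K"
  using closed_interpolating_order.limit_le[OF dual assms(1)] assms(2) by auto

section \<open>Compact neighbourhoods and shells\<close>

lemma compact_neighbourhood:
  assumes "openin X W" "x \<in> W"
  obtains U V where "openin X U" "compactin X V" "closedin X V" "x \<in> U" "U \<subseteq> V" "V \<subseteq> W"
proof -
  have "neighbourhood_base_of (\<lambda>C. compactin X C \<and> closedin X C) X"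
    using locally_compact_regular_space_neighbourhood_base[of X]
      locally_compact_Hausdorff_imp_regular_space[OF locally_compact Hausdorff] locally_compact
    by blast
  then show ?thesis
    using assms that unfolding neighbourhood_base_of by meson
qed

lemma compactin_shell:
  assumes "openin X U" "compactin X V"
  shows "compactin X (V - U)"
proof -
  have "V \<inter> (topspace X - U) = V - U"
    using compactin_subset_topspace[OF assms(2)] by auto
  then show ?thesis
    using compact_Int_closedin[OF assms(2), of "topspace X - U"] assms(1) by auto
qed

text \<open>This is \<open>interpolation\<close> for \<open>C = V\<close> and \<open>D\<close> the
  complement of \<open>U\<close>: leaving a compact neighbourhood means crossing the shell
  \<open>V - U\<close>.\<close>

lemma interpolation_shell:
  assumes "openin X U" "compactin X V" "closedin X V" "U \<subseteq> V" "(a, b) \<in> K" "a \<notin> V" "b \<in> U"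
  shows "\<exists>w\<in>V - U. (a, w) \<in> K \<and> (w, b) \<in> K"
proof -
  have "V \<subseteq> topspace X"
    using assms(3) closedin_subset by blast
  then have eq: "V \<inter> (topspace X - U) = V - U"
    by auto
  have cl: "closedin X (topspace X - U)"
    using assms(1) by auto
  show ?thesis
    using interpolation[OF assms(5,3) cl] compactin_shell[OF assms(1,2)] assms(4,6,7) \<open>V \<subseteq> topspace X\<close> eq by auto
qed

text \<open>If \<open>x\<close> had a neighbourhood inside the future of \<open>p\<close>, the points of an increasing sequence
  lying outside it would be joined to \<open>x\<close> through a compact shell around \<open>x\<close>, and a cluster
  point on the shell would be an upper bound of the sequence strictly below \<open>x\<close>.\<close>

lemma future_diff_bd: "K `` {p} - future_bd (topspace X) K p = X interior_of (K `` {p})"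
proof (intro equalityI subsetI)
  fix x
  assume x: "x \<in> K `` {p} - future_bd (topspace X) K p"
  then have xX: "x \<in> topspace X" using K_subset by auto
  obtain y where lim: "limitin X y x sequentially" and y: "\<And>n. (y n, y (Suc n)) \<in> K"
    and int: "\<And>n. x \<in> X interior_of (K `` {y n})"
    using approx_below[OF xX] by blast
  \<comment> \<open>If all \<open>y n\<close> lay outside the future of \<open>p\<close>, they would
    witness that \<open>x\<close> is in the boundary: \<open>x\<close> is an upper bound, and it is
    the least one because \<open>y\<close> converges to \<open>x\<close> and pasts are
    closed.\<close>
  have "\<exists>n. (p, y n) \<in> K"
  proof (rule ccontr)
    assume "\<nexists>n. (p, y n) \<in> K"
    moreover have "y n \<in> topspace X" for n
      using y K_subset by blast
    moreover have "(y n, x) \<in> K" for n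
      using int[of n] interior_of_subset[of X] by blast
    moreover have "is_supremum K (topspace X) (range y) x"
      using calculation(3) xX limit_le[OF lim] by (simp add: is_supremum_def)
    ultimately have "x \<in> future_bd (topspace X) K p"
      using x y unfolding future_bd_def by blast
    then show False using x by simp
  qed
  then obtain n where "(p, y n) \<in> K" ..
  then have "K `` {y n} \<subseteq> K `` {p}"
    using K_trans by auto
  then show "x \<in> X interior_of (K `` {p})"
    using int[of n] interior_of_mono by blast
next
  fix x
  assume x: "x \<in> X interior_of (K `` {p})"
  then have "x \<in> K `` {p}"
    using interior_of_subset by fastforce
  moreover have "x \<notin> future_bd (topspace X) K p"
  proof
    assume "x \<in> future_bd (topspace X) K p"
    then obtain y where y: "\<And>i. y i \<in> topspace X - K `` {p}" "\<And>i. (y i, y (Suc i)) \<in> K"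
      and sup: "is_supremum K (topspace X) (range y) x"
      unfolding future_bd_def by auto
    obtain U V where UV: "openin X U" "compactin X V" "closedin X V" "x \<in> U" "U \<subseteq> V"
      "V \<subseteq> X interior_of (K `` {p})"
      using compact_neighbourhood[OF openin_interior_of x] .
    have xX: "x \<in> topspace X" and yx: "(y i, x) \<in> K" for i
      using sup by (auto simp: is_supremum_def)
    have "y i \<notin> V" for i
      using y(1) UV(6) interior_of_subset by fastforce
    then have "\<exists>w\<in>V - U. (y i, w) \<in> K \<and> (w, x) \<in> K" for i
      using interpolation_shell UV yx by blast
    \<comment> \<open>The constant sequence \<open>x\<close> serves as the decreasing upper end of
      the intervals.\<close>
    then obtain w where w: "w \<in> V - U" "\<And>i. (y i, w) \<in> K" "(w, x) \<in> K"
      using compact_nested_intervals[OF compactin_shell[OF UV(1,2)], of y "\<lambda>_. x"]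
        y(2) K_refl[OF xX] by auto
    then have "(x, w) \<in> K"
      using sup K_subset by (auto simp: is_supremum_def)
    then show False
      using w UV(4) K_antisym by blast
  qed
  ultimately show "x \<in> K `` {p} - future_bd (topspace X) K p" by simp
qed

lemma past_diff_bd: "K\<inverse> `` {q} - future_bd (topspace X) (K\<inverse>) q = X interior_of (K\<inverse> `` {q})"
  by (rule closed_interpolating_order.future_diff_bd[OF dual])

lemma interval_neighbourhood:
  assumes "openin X W" "x \<in> W"
  obtains p q where "p \<in> topspace X" "q \<in> topspace X"
    "x \<in> X interior_of (K `` {p}) \<inter> X interior_of (K\<inverse> `` {q})"
    "K `` {p} \<inter> K\<inverse> `` {q} \<subseteq> W"
proof -
  have xX: "x \<in> topspace X"
    using assms openin_subset by blast
  obtain p where p: "limitin X p x sequentially" "\<And>n. (p n, p (Suc n)) \<in> K"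
    "\<And>n. x \<in> X interior_of (K `` {p n})"
    using approx_below[OF xX] by blast
  obtain q where q: "limitin X q x sequentially" "\<And>n. (q (Suc n), q n) \<in> K"
    "\<And>n. x \<in> X interior_of (K\<inverse> `` {q n})"
    using approx_above[OF xX] by blast
  obtain U V where UV: "openin X U" "compactin X V" "closedin X V" "x \<in> U" "U \<subseteq> V" "V \<subseteq> W"
    using compact_neighbourhood[OF assms] .
  obtain N where N: "q n \<in> U" if "n \<ge> N" for n
    using q(1) UV(1,4) unfolding limitin_sequentially by blast
  have "\<exists>n. K `` {p n} \<inter> K\<inverse> `` {q n} \<subseteq> W"
  proof (rule ccontr)
    assume no: "\<nexists>n. K `` {p n} \<inter> K\<inverse> `` {q n} \<subseteq> W"
    have "\<exists>w\<in>V - U. (p n, w) \<in> K \<and> (w, q n) \<in> K" for n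
    proof -
      \<comment> \<open>Beyond \<open>N\<close> the upper end \<open>q ?m\<close> lies in
        \<open>U\<close>, so the chain from \<open>z\<close> to \<open>q ?m\<close> crosses the
        shell. Monotonicity carries the crossing point back to the index \<open>n\<close>.\<close>
      let ?m = "max n N"
      obtain z where z: "(p ?m, z) \<in> K" "(z, q ?m) \<in> K" "z \<notin> W"
        using no by blast
      moreover have "q ?m \<in> U" "z \<notin> V"
        using N[of ?m] z(3) UV(6) by auto
      ultimately obtain w where "w \<in> V - U" "(z, w) \<in> K" "(w, q ?m) \<in> K"
        using interpolation_shell[OF UV(1,2,3,5)] by blast
      moreover have "(p n, p ?m) \<in> K" "(q ?m, q n) \<in> K"
        using increasing_sequence[of p n ?m] decreasing_sequence[of q n ?m] p(2) q(2) by auto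
      ultimately show ?thesis
        using z(1) K_trans by blast
    qed
    then obtain w where w: "w \<in> V - U" "\<And>n. (p n, w) \<in> K" "\<And>n. (w, q n) \<in> K"
      using compact_nested_intervals[of "V - U" p q] compactin_shell[OF UV(1,2)] p(2) q(2) by blast
    then have "(x, w) \<in> K" "(w, x) \<in> K"
      using limit_le[OF p(1)] le_limit[OF q(1)] by blast+
    then show False
      using w(1) UV(4) K_antisym by blast
  qed
  then obtain n where "K `` {p n} \<inter> K\<inverse> `` {q n} \<subseteq> W" ..
  moreover have "p n \<in> topspace X" "q n \<in> topspace X"
    using p(2) q(2) K_subset by blast+
  ultimately show thesis
    using that p(3) q(3) by blast
qed

end

section \<open>Interpolation for closed transitive hulls\<close>

text \<open>The relation is the image of a closed set of triples \<open>(w, a, b)\<close> under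
  projection along the compact factor \<open>B\<close>, and such a projection is a closed
  map.\<close>

lemma compactly_intermediate_closedin:
  assumes K: "closedin (prod_topology X X) K" and "compactin X B"
  shows "closedin (prod_topology X X) {(a, b). \<exists>w\<in>B. (a, w) \<in> K \<and> (w, b) \<in> K}"
proof -
  let ?P = "prod_topology (subtopology X B) (prod_topology X X)"
  have "B \<subseteq> topspace X"
    using assms(2) compactin_subset_topspace by blast
  have KX: "K \<subseteq> topspace X \<times> topspace X"
    using closedin_subset[OF K] by simp
  have fst: "continuous_map ?P X fst"
    using continuous_map_fst continuous_map_in_subtopology by blast
  have snd: "continuous_map ?P (prod_topology X X) snd"
    by (rule continuous_map_snd)
  have "continuous_map ?P (prod_topology X X) (\<lambda>z. (fst (snd z), fst z))"
    "continuous_map ?P (prod_topology X X) (\<lambda>z. (fst z, snd (snd z)))"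
    by (intro continuous_map_pairedI fst
        continuous_map_compose[OF snd continuous_map_fst, unfolded o_def]
        continuous_map_compose[OF snd continuous_map_snd, unfolded o_def])+
  then have "closedin ?P ({z \<in> topspace ?P. (fst (snd z), fst z) \<in> K} \<inter>
      {z \<in> topspace ?P. (fst z, snd (snd z)) \<in> K})" (is "closedin _ ?S")
    by (intro closedin_Int closedin_continuous_map_preimage[OF _ K])
  moreover have "compact_space (subtopology X B)"
    using assms(2) compactin_subspace by blast
  ultimately have "closedin (prod_topology X X) (snd ` ?S)"
    using closed_map_snd[of "subtopology X B" "prod_topology X X"] unfolding closed_map_def by blast
  also have "snd ` ?S = {(a, b). \<exists>w\<in>B. (a, w) \<in> K \<and> (w, b) \<in> K}"
  proof (intro equalityI subsetI)
    fix z
    assume "z \<in> {(a, b). \<exists>w\<in>B. (a, w) \<in> K \<and> (w, b) \<in> K}"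
    then obtain a b w where "z = (a, b)" "w \<in> B" "(a, w) \<in> K" "(w, b) \<in> K"
      by blast
    moreover from this have "(w, a, b) \<in> ?S"
      using \<open>B \<subseteq> topspace X\<close> KX by auto
    ultimately show "z \<in> snd ` ?S"
      by (intro image_eqI[of z snd "(w, a, b)"]) simp_all
  qed auto
  finally show ?thesis .
qed

text \<open>By minimality of the hull it suffices that the pairs of \<open>K\<close> obeying the
  claim form a closed transitive relation containing \<open>I\<close>. For pairs in \<open>I\<close>
  the claim comes from connectedness.\<close>

lemma closed_transitive_hull_interpolation:
  assumes K: "K = \<Inter>{R. I \<subseteq> R \<and> trans R \<and> closedin (prod_topology X X) R}"
    and closedK: "closedin (prod_topology X X) K"
    and I: "\<And>a b. (a, b) \<in> I \<Longrightarrow>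
      \<exists>S. connectedin X S \<and> a \<in> S \<and> b \<in> S \<and> (\<forall>w\<in>S. (a, w) \<in> K \<and> (w, b) \<in> K)"
    and ab: "(a, b) \<in> K" and C: "closedin X C" and D: "closedin X D" and CD: "C \<union> D = topspace X"
    and compact: "compactin X (C \<inter> D)" and "a \<notin> C" "b \<notin> D"
  shows "\<exists>w\<in>C \<inter> D. (a, w) \<in> K \<and> (w, b) \<in> K"
proof -
  let ?S = "{(a, b). \<exists>w\<in>C \<inter> D. (a, w) \<in> K \<and> (w, b) \<in> K}"
  \<comment> \<open>The implication from \<open>a \<notin> C\<close> and \<open>b \<notin> D\<close>
    is written as a union of three closed sets, which makes closedness of \<open>R\<close>
    visible.\<close>
  define R where "R = K \<inter> (C \<times> topspace X \<union> topspace X \<times> D \<union> ?S)"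
  have transK: "trans K"
    unfolding K trans_def by blast
  have KX: "K \<subseteq> topspace X \<times> topspace X"
    using closedin_subset[OF closedK] by simp
  have "closedin (prod_topology X X) R"
    unfolding R_def using C D compact
    by (intro closedin_Int closedin_Un closedK compactly_intermediate_closedin)
      (auto simp: closedin_prod_Times_iff)
  moreover have "trans R"
  proof (rule transI)
    fix x y z
    assume xy: "(x, y) \<in> R" and yz: "(y, z) \<in> R"
    then have K3: "(x, y) \<in> K" "(y, z) \<in> K" "(x, z) \<in> K"
      using transK by (auto simp: R_def dest: transD)
    \<comment> \<open>The last case is the decisive one: if \<open>y \<in> D\<close> is what puts
      the first pair into \<open>R\<close> and \<open>y \<in> C\<close> the second, then
      \<open>y\<close> itself is the intermediate point.\<close>
    consider "(x, y) \<in> ?S" | "(y, z) \<in> ?S" | "x \<in> C" | "z \<in> D" | "y \<in> C \<inter> D"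
      using xy yz unfolding R_def by blast
    then have "x \<in> C \<or> z \<in> D \<or> (x, z) \<in> ?S"
      using K3 transD[OF transK] by cases blast+
    then show "(x, z) \<in> R"
      using K3 KX unfolding R_def by blast
  qed
  moreover have "I \<subseteq> R"
  proof clarify
    fix x y
    assume "(x, y) \<in> I"
    then obtain S where S: "connectedin X S" "x \<in> S" "y \<in> S" "\<forall>w\<in>S. (x, w) \<in> K \<and> (w, y) \<in> K"
      using I by blast
    have "x \<in> C \<or> y \<in> D \<or> C \<inter> D \<inter> S \<noteq> {}"
    proof (rule ccontr)
      \<comment> \<open>Otherwise \<open>C\<close> and \<open>D\<close> would split the connected
        set \<open>S\<close> into two disjoint relatively closed parts, containing \<open>y\<close>
        and \<open>x\<close> respectively.\<close>
      assume no: "\<not> (x \<in> C \<or> y \<in> D \<or> C \<inter> D \<inter> S \<noteq> {})"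
      have "S \<subseteq> C \<union> D"
        using S(1) CD connectedin_subset_topspace by blast
      moreover have "y \<in> C" "x \<in> D"
        using calculation S(2,3) no by auto
      ultimately show False
        using S(1-3) C D no unfolding connectedin_closedin by (metis IntI emptyE)
    qed
    then have "(x, y) \<in> C \<times> topspace X \<union> topspace X \<times> D \<union> ?S"
      using S(2-4) KX by fast
    moreover have "(x, y) \<in> K"
      using S(3,4) by blast
    ultimately show "(x, y) \<in> R"
      unfolding R_def by blast
  qed
  ultimately have "K \<subseteq> R"
    unfolding K by blast
  then show ?thesis
    using ab \<open>a \<notin> C\<close> \<open>b \<notin> D\<close> unfolding R_def by blast
qed

section \<open>Charts\<close>

lemma is_chart_inv:
  assumes "is_chart X c"
  shows "p \<in> chart_dom c \<Longrightarrow> chart_inv c (chart_map c p) = p"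
    and "z \<in> chart_map c ` chart_dom c \<Longrightarrow> chart_map c (chart_inv c z) = z"
    and "z \<in> chart_map c ` chart_dom c \<Longrightarrow> chart_inv c z \<in> chart_dom c"
proof -
  have "topspace (subtopology X (chart_dom c)) = chart_dom c"
    using assms openin_subset unfolding is_chart_def by fastforce
  then have "inj_on (chart_map c) (chart_dom c)"
    using assms homeomorphic_imp_injective_map unfolding is_chart_def by metis
  then show "p \<in> chart_dom c \<Longrightarrow> chart_inv c (chart_map c p) = p"
    by (simp add: chart_inv_def)
qed (simp_all add: chart_inv_def f_inv_into_f inv_into_into)

text \<open>\<open>chart_inv\<close> is built from \<open>inv_into\<close>; on the image of the
  chart it agrees with the continuous inverse that the homeomorphism provides.\<close>

lemma continuous_map_chart_inv:
  assumes c: "is_chart X c"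
  shows "continuous_map (top_of_set (chart_map c ` chart_dom c)) X (chart_inv c)"
proof -
  have top: "topspace (subtopology X (chart_dom c)) = chart_dom c"
    using c openin_subset unfolding is_chart_def by fastforce
  obtain g where g: "homeomorphic_maps (subtopology X (chart_dom c))
      (top_of_set (chart_map c ` chart_dom c)) (chart_map c) g"
    using c unfolding is_chart_def homeomorphic_map_maps by blast
  then have "continuous_map (top_of_set (chart_map c ` chart_dom c)) X g"
    unfolding homeomorphic_maps_def continuous_map_in_subtopology by blast
  then show ?thesis
  proof (rule continuous_map_eq)
    fix z
    assume "z \<in> topspace (top_of_set (chart_map c ` chart_dom c))"
    then obtain p where "p \<in> chart_dom c" "z = chart_map c p"
      by auto
    then show "g z = chart_inv c z"
      using g top is_chart_inv(1)[OF c] unfolding homeomorphic_maps_def by auto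
  qed
qed

lemma openin_chart_vimage:
  assumes "is_chart X c" "open W"
  shows "openin X {p \<in> chart_dom c. chart_map c p \<in> W}"
proof -
  have top: "topspace (subtopology X (chart_dom c)) = chart_dom c"
    using assms openin_subset unfolding is_chart_def by fastforce
  have "continuous_map (subtopology X (chart_dom c)) euclidean (chart_map c)"
    using assms homeomorphic_imp_continuous_map continuous_map_in_subtopology
    unfolding is_chart_def by blast
  from openin_continuous_map_preimage[OF this, of W] assms(2)
  have "openin (subtopology X (chart_dom c)) {p \<in> chart_dom c. chart_map c p \<in> W}"
    unfolding top by simp
  then show ?thesis
    using assms(1) openin_trans_full unfolding is_chart_def by blast
qed

text \<open>Closed balls inside the open image of a chart pull back to compact
  neighbourhoods.\<close>

lemma locally_compact_smooth_atlas:
  assumes "smooth_atlas X \<A>"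
  shows "locally_compact_space X"
  unfolding locally_compact_space_def
proof
  fix x
  assume "x \<in> topspace X"
  then obtain c where c: "c \<in> \<A>" "x \<in> chart_dom c" "is_chart X c"
    using assms unfolding smooth_atlas_def by blast
  have "open (chart_map c ` chart_dom c)"
    using c(3) unfolding is_chart_def by blast
  then obtain r where r: "r > 0" "cball (chart_map c x) r \<subseteq> chart_map c ` chart_dom c"
    using c(2) open_contains_cball by blast
  let ?U = "{p \<in> chart_dom c. chart_map c p \<in> ball (chart_map c x) r}"
  have "compactin (top_of_set (chart_map c ` chart_dom c)) (cball (chart_map c x) r)"
    using r(2) by (simp add: compactin_subtopology)
  then have "compactin X (chart_inv c ` cball (chart_map c x) r)"
    using image_compactin continuous_map_chart_inv[OF c(3)] by blast
  moreover have "?U \<subseteq> chart_inv c ` cball (chart_map c x) r"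
  proof
    fix p
    assume "p \<in> ?U"
    then show "p \<in> chart_inv c ` cball (chart_map c x) r"
      using is_chart_inv(1)[OF c(3), of p] by (intro image_eqI[of _ _ "chart_map c p"]) auto
  qed
  moreover have "openin X ?U"
    by (rule openin_chart_vimage[OF c(3) open_ball])
  moreover have "x \<in> ?U"
    using c(2) r(1) by simp
  ultimately show "\<exists>U K. openin X U \<and> compactin X K \<and> x \<in> U \<and> U \<subseteq> K"
    by blast
qed

text \<open>Smoothness of the metric is stated for fixed vectors. Expanding both arguments in the
  finite basis turns this into joint continuity in the point and the vectors.\<close>

lemma continuous_on_bilinear_family:
  fixes B :: "'z::topological_space \<Rightarrow> 'e::euclidean_space \<Rightarrow> 'e \<Rightarrow> real"
  assumes "\<And>z. z \<in> S \<Longrightarrow> bilinear (B z)"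
    and "\<And>v w. continuous_on S (\<lambda>z. B z v w)"
    and f: "continuous_on T f" "f ` T \<subseteq> S" and g: "continuous_on T g" and h: "continuous_on T h"
  shows "continuous_on T (\<lambda>t. B (f t) (g t) (h t))"
proof -
  have "B z v w = (\<Sum>i\<in>Basis. \<Sum>j\<in>Basis. (v \<bullet> i) * (w \<bullet> j) * B z i j)" if "z \<in> S" for z v w
  proof -
    have B: "bilinear (B z)" using assms(1) that .
    have "B z v w = B z (\<Sum>i\<in>Basis. (v \<bullet> i) *\<^sub>R i) (\<Sum>j\<in>Basis. (w \<bullet> j) *\<^sub>R j)"
      by (simp add: euclidean_representation)
    also have "\<dots> = (\<Sum>(i, j)\<in>Basis \<times> Basis. B z ((v \<bullet> i) *\<^sub>R i) ((w \<bullet> j) *\<^sub>R j))"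
      by (rule bilinear_sum[OF B])
    finally show ?thesis
      by (simp add: bilinear_lmul[OF B] bilinear_rmul[OF B] sum.cartesian_product mult_ac)
  qed
  then have "continuous_on T (\<lambda>t. B (f t) (g t) (h t)) \<longleftrightarrow>
      continuous_on T (\<lambda>t. \<Sum>i\<in>Basis. \<Sum>j\<in>Basis. (g t \<bullet> i) * (h t \<bullet> j) * B (f t) i j)"
    using f(2) by (intro continuous_on_cong) auto
  moreover have "continuous_on T (\<lambda>t. \<Sum>i\<in>Basis. \<Sum>j\<in>Basis. (g t \<bullet> i) * (h t \<bullet> j) * B (f t) i j)"
    by (intro continuous_intros g h continuous_on_compose2[OF assms(2) f])
  ultimately show ?thesis by blast
qed

section \<open>Chronology\<close>

context
  fixes M :: "('a, 'e::euclidean_space) spacetime_data"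
  assumes spacetime: "spacetime M"
begin

lemma atlas_is_chart: "c \<in> atlas M \<Longrightarrow> is_chart (space_top M) c"
  using spacetime by (simp add: spacetime_def smooth_manifold_def smooth_atlas_def)

lemma metric_bilinear: "c \<in> atlas M \<Longrightarrow> p \<in> chart_dom c \<Longrightarrow> bilinear (metric M c p)"
  using spacetime by (simp add: spacetime_def lorentz_metric_def lorentz_form_def)

lemma future_timelike_scaleR:
  assumes "c \<in> atlas M" "p \<in> chart_dom c" "k > 0" "future_timelike M c p v"
  shows "future_timelike M c p (k *\<^sub>R v)"
  using assms metric_bilinear[OF assms(1,2)]
  by (simp add: future_timelike_def bilinear_lmul bilinear_rmul mult_pos_neg)

lemma future_timelike_transition:
  assumes "c \<in> atlas M" "d \<in> atlas M" "p \<in> chart_dom c \<inter> chart_dom d" "future_timelike M c p v"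
  shows "future_timelike M d p (frechet_derivative (transition c d) (at (chart_map c p)) v)"
proof -
  let ?D = "frechet_derivative (transition c d) (at (chart_map c p))"
  have "metric M c p v w = metric M d p (?D v) (?D w)" for v w
    using spacetime assms(1-3) unfolding spacetime_def lorentz_metric_def Let_def by blast
  moreover have "time_field M d p = ?D (time_field M c p)"
    using spacetime assms(1-3) unfolding spacetime_def time_orientation_def by blast
  ultimately show ?thesis
    using assms(4) by (simp add: future_timelike_def)
qed

text \<open>Both conditions of \<open>future_timelike\<close> are strict inequalities between
  jointly continuous functions. This openness is what makes timelike displacements stable under
  perturbation.\<close>

lemma open_future_timelike:
  assumes c: "c \<in> atlas M"
  shows "open {(z, v). z \<in> chart_map c ` chart_dom c \<and> future_timelike M c (chart_inv c z) v}"
proof -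
  let ?S = "chart_map c ` chart_dom c"
  have S: "open ?S"
    using atlas_is_chart[OF c] by (simp add: is_chart_def)
  have bil: "bilinear (metric M c (chart_inv c z))" if "z \<in> ?S" for z
    using metric_bilinear[OF c] is_chart_inv(3)[OF atlas_is_chart[OF c] that] .
  have "smooth_map_on ?S (\<lambda>z. metric M c (chart_inv c z) v w)" for v w
    using spacetime c unfolding spacetime_def lorentz_metric_def by blast
  then have con: "continuous_on ?S (\<lambda>z. metric M c (chart_inv c z) v w)" for v w
    unfolding smooth_map_on_def using times_cont_diff_on.simps(1) by blast
  have "continuous_on ?S (\<lambda>z. time_field M c (chart_inv c z))"
    using spacetime c unfolding spacetime_def time_orientation_def by blast
  then have T: "continuous_on (?S \<times> UNIV) (\<lambda>t. time_field M c (chart_inv c (fst t)))"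
    by (rule continuous_on_compose2[where g = "\<lambda>z. time_field M c (chart_inv c z)"])
      (auto intro: continuous_intros)
  have "continuous_on (?S \<times> UNIV) (\<lambda>t. metric M c (chart_inv c (fst t)) (snd t) (snd t))"
    by (rule continuous_on_bilinear_family[OF bil con]) (auto intro: continuous_intros)
  moreover have "continuous_on (?S \<times> UNIV)
      (\<lambda>t. metric M c (chart_inv c (fst t)) (snd t) (time_field M c (chart_inv c (fst t))))"
    by (rule continuous_on_bilinear_family[OF bil con]) (auto intro: continuous_intros T)
  ultimately have "open ((\<lambda>t. metric M c (chart_inv c (fst t)) (snd t) (snd t)) -` {..<0} \<inter> (?S \<times> UNIV))"
    "open ((\<lambda>t. metric M c (chart_inv c (fst t)) (snd t) (time_field M c (chart_inv c (fst t)))) -` {..<0}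
       \<inter> (?S \<times> UNIV))"
    using S by (auto simp: continuous_on_open_vimage open_Times)
  then have "open (((\<lambda>t. metric M c (chart_inv c (fst t)) (snd t) (snd t)) -` {..<0} \<inter> (?S \<times> UNIV)) \<inter>
    ((\<lambda>t. metric M c (chart_inv c (fst t)) (snd t) (time_field M c (chart_inv c (fst t)))) -` {..<0}
       \<inter> (?S \<times> UNIV)))"
    by (rule open_Int)
  also have "\<dots> = {(z, v). z \<in> ?S \<and> future_timelike M c (chart_inv c z) v}"
    by (auto simp: future_timelike_def)
  finally show ?thesis .
qed

text \<open>The subarc is rescaled to the unit interval by an affine map \<open>h\<close>. Break
  points are pulled back along \<open>h\<close>, and tangents are multiplied by the positive factor
  \<open>t - s\<close>.\<close>

lemma timelike_curve_chronological:
  assumes \<gamma>: "timelike_curve M \<gamma>" and st: "0 \<le> s" "s < t" "t \<le> 1"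
  shows "(\<gamma> s, \<gamma> t) \<in> I_plus M"
proof -
  define h where "h u = s + u * (t - s)" for u
  have h_le: "h u \<le> h v \<longleftrightarrow> u \<le> v" and h_less: "h u < h v \<longleftrightarrow> u < v" for u v
    using st by (simp_all add: h_def)
  have h01: "h 0 = s" "h 1 = t"
    by (simp_all add: h_def)
  have h_cont: "continuous_on A h" for A
    unfolding h_def by (intro continuous_intros)
  have h_deriv: "(h has_vector_derivative (t - s)) (at u within A)" for u A
    unfolding h_def by (auto intro!: derivative_eq_intros)
  have "h ` {0..1} \<subseteq> {0..1}"
  proof (rule image_subsetI)
    fix u :: real
    assume "u \<in> {0..1}"
    then have "h 0 \<le> h u" "h u \<le> h 1"
      by (simp_all add: h_le)
    then show "h u \<in> {0..1}"
      using st by (simp add: h01)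
  qed
  then have "continuous_map (top_of_set {0..1}) (top_of_set {0..1}) h"
    using h_cont by (auto simp: continuous_map_in_subtopology)
  then have "continuous_map (top_of_set {0..1}) (space_top M) (\<gamma> \<circ> h)"
    using \<gamma> continuous_map_compose unfolding timelike_curve_def by blast
  moreover obtain S where S: "finite S"
    "\<And>a b. 0 \<le> a \<Longrightarrow> a < b \<Longrightarrow> b \<le> 1 \<Longrightarrow> S \<inter> {a<..<b} = {} \<Longrightarrow> C1_timelike_arc M a b \<gamma>"
    using \<gamma> unfolding timelike_curve_def by blast
  have "C1_timelike_arc M a b (\<gamma> \<circ> h)"
    if ab: "0 \<le> a" "a < b" "b \<le> 1" "h -` S \<inter> {a<..<b} = {}" for a b
    unfolding C1_timelike_arc_def
  proof
    fix c
    assume c: "c \<in> atlas M"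
    have "S \<inter> {h a<..<h b} = {}"
    proof (rule ccontr)
      assume "S \<inter> {h a<..<h b} \<noteq> {}"
      then obtain x where x: "x \<in> S" "h a < x" "x < h b"
        by auto
      have "h ((x - s) / (t - s)) = x"
        using st by (simp add: h_def)
      then show False
        using ab(4) x h_less by (metis IntI emptyE greaterThanLessThan_iff vimageI)
    qed
    moreover have "0 \<le> h a" "h b \<le> 1" "h a < h b"
      using ab st h_le[of 0 a] h_le[of b 1] h01 h_less by auto
    ultimately have "C1_timelike_arc M (h a) (h b) \<gamma>"
      by (intro S(2))
    then obtain \<gamma>' where cont: "continuous_on {t\<in>{h a..h b}. \<gamma> t \<in> chart_dom c} \<gamma>'"
      and deriv: "\<And>u. u \<in> {h a..h b} \<Longrightarrow> \<gamma> u \<in> chart_dom c \<Longrightarrow>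
           ((\<lambda>s. chart_map c (\<gamma> s)) has_vector_derivative \<gamma>' u) (at u within {h a..h b}) \<and>
           future_timelike M c (\<gamma> u) (\<gamma>' u)"
      using c unfolding C1_timelike_arc_def by blast
    have h_ab: "h ` {a..b} \<subseteq> {h a..h b}"
      using h_le by auto
    show "\<exists>\<gamma>'. continuous_on {t\<in>{a..b}. (\<gamma> \<circ> h) t \<in> chart_dom c} \<gamma>' \<and>
        (\<forall>t\<in>{a..b}. (\<gamma> \<circ> h) t \<in> chart_dom c \<longrightarrow>
           ((\<lambda>s. chart_map c ((\<gamma> \<circ> h) s)) has_vector_derivative \<gamma>' t) (at t within {a..b}) \<and>
           future_timelike M c ((\<gamma> \<circ> h) t) (\<gamma>' t))"
    proof (intro exI[of _ "\<lambda>u. (t - s) *\<^sub>R \<gamma>' (h u)"] conjI ballI impI)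
      show "continuous_on {t\<in>{a..b}. (\<gamma> \<circ> h) t \<in> chart_dom c} (\<lambda>u. (t - s) *\<^sub>R \<gamma>' (h u))"
        by (intro continuous_intros continuous_on_compose2[OF cont h_cont]) (auto simp: h_le)
    next
      fix u
      assume u: "u \<in> {a..b}" "(\<gamma> \<circ> h) u \<in> chart_dom c"
      then have hu: "h u \<in> {h a..h b}" "\<gamma> (h u) \<in> chart_dom c"
        by (simp_all add: h_le)
      show "((\<lambda>s. chart_map c ((\<gamma> \<circ> h) s)) has_vector_derivative (t - s) *\<^sub>R \<gamma>' (h u))
          (at u within {a..b})"
        using vector_diff_chain_within[OF h_deriv
            has_vector_derivative_within_subset[OF conjunct1[OF deriv[OF hu]] h_ab]]
        by (simp add: o_def)
      show "future_timelike M c ((\<gamma> \<circ> h) u) ((t - s) *\<^sub>R \<gamma>' (h u))"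
        using future_timelike_scaleR[OF c hu(2)] deriv[OF hu] st by simp
    qed
  qed
  moreover have "finite (h -` S)"
    using st S(1) by (intro finite_vimageI) (auto simp: inj_on_def h_def)
  ultimately have "timelike_curve M (\<gamma> \<circ> h)"
    unfolding timelike_curve_def by (intro conjI exI[of _ "h -` S"]) auto
  then show ?thesis
    unfolding I_plus_def using h01 by (auto intro!: exI[of _ "\<gamma> \<circ> h"])
qed

section \<open>Straight segments and local timelike curves\<close>

text \<open>The curve is a straight line in the chart \<open>c\<close>, but
  \<open>C1_timelike_arc\<close> has to be verified in every chart \<open>d\<close>. There the
  tangent is the derivative of the transition map applied to \<open>v\<close>; it varies
  continuously by smoothness and is future timelike by the transformation laws.\<close>

lemma segment_chronological:
  assumes c: "c \<in> atlas M"
    and seg: "\<And>t. t \<in> {0..1} \<Longrightarrow> a + t *\<^sub>R v \<in> chart_map c ` chart_dom c"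
    and fut: "\<And>t. t \<in> {0..1} \<Longrightarrow> future_timelike M c (chart_inv c (a + t *\<^sub>R v)) v"
  shows "(chart_inv c a, chart_inv c (a + v)) \<in> I_plus M"
proof -
  note inv = is_chart_inv[OF atlas_is_chart[OF c]]
  define l where "l t = a + t *\<^sub>R v" for t
  have l_cont: "continuous_on A l" for A
    unfolding l_def by (intro continuous_intros)
  have l_deriv: "(l has_vector_derivative v) (at t within A)" for t A
    unfolding l_def by (auto intro!: derivative_eq_intros)
  define \<gamma> where "\<gamma> = chart_inv c \<circ> l"
  have "continuous_map (top_of_set {0..1}) (top_of_set (chart_map c ` chart_dom c)) l"
    using seg l_cont by (auto simp: continuous_map_in_subtopology l_def)
  then have "continuous_map (top_of_set {0..1}) (space_top M) \<gamma>"
    unfolding \<gamma>_def by (rule continuous_map_compose[OF _ continuous_map_chart_inv[OF atlas_is_chart[OF c]]])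
  moreover have "C1_timelike_arc M s e \<gamma>" if se: "0 \<le> s" "s < e" "e \<le> 1" for s e
    unfolding C1_timelike_arc_def
  proof
    fix d
    assume d: "d \<in> atlas M"
    let ?O = "chart_map c ` (chart_dom c \<inter> chart_dom d)"
    let ?D = "\<lambda>z. frechet_derivative (transition c d) (at z)"
    have "smooth_map_on ?O (transition c d)"
      using spacetime c d unfolding spacetime_def smooth_manifold_def smooth_atlas_def by blast
    then have "times_cont_diff_on (Suc 0) ?O (transition c d)"
      unfolding smooth_map_on_def by blast
    then have diff: "\<And>z. z \<in> ?O \<Longrightarrow> transition c d differentiable (at z)"
      and cont: "continuous_on ?O (\<lambda>z. ?D z v)"
      by auto
    have \<gamma>_c: "\<gamma> t \<in> chart_dom c" "chart_map c (\<gamma> t) = l t" if "t \<in> {s..e}" for t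
      using inv(2,3)[OF seg[of t]] that se by (auto simp: \<gamma>_def l_def)
    have l_O: "l t \<in> ?O" if "t \<in> {s..e}" "\<gamma> t \<in> chart_dom d" for t
      using \<gamma>_c[OF that(1)] that(2) by (metis IntI imageI)
    show "\<exists>\<gamma>'. continuous_on {t\<in>{s..e}. \<gamma> t \<in> chart_dom d} \<gamma>' \<and>
        (\<forall>t\<in>{s..e}. \<gamma> t \<in> chart_dom d \<longrightarrow>
           ((\<lambda>s. chart_map d (\<gamma> s)) has_vector_derivative \<gamma>' t) (at t within {s..e}) \<and>
           future_timelike M d (\<gamma> t) (\<gamma>' t))"
    proof (intro exI[of _ "\<lambda>t. ?D (l t) v"] conjI ballI impI)
      show "continuous_on {t\<in>{s..e}. \<gamma> t \<in> chart_dom d} (\<lambda>t. ?D (l t) v)"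
        using l_O by (intro continuous_on_compose2[OF cont l_cont]) auto
    next
      fix t
      assume t: "t \<in> {s..e}" "\<gamma> t \<in> chart_dom d"
      have "(transition c d has_derivative ?D (l t)) (at (l t))"
        using diff[OF l_O[OF t]] frechet_derivative_works by blast
      then have "((transition c d \<circ> l) has_vector_derivative ?D (l t) v) (at t within {s..e})"
        by (rule vector_derivative_diff_chain_within[OF l_deriv has_derivative_at_withinI])
      then show "((\<lambda>s. chart_map d (\<gamma> s)) has_vector_derivative ?D (l t) v) (at t within {s..e})"
        by (simp add: \<gamma>_def transition_def o_def)
      have "future_timelike M c (\<gamma> t) v"
        using fut[of t] t(1) se by (auto simp: \<gamma>_def l_def)
      then show "future_timelike M d (\<gamma> t) (?D (l t) v)"
        using future_timelike_transition[OF c d, of "\<gamma> t" v] \<gamma>_c[OF t(1)] t(2) by auto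
    qed
  qed
  ultimately have "timelike_curve M \<gamma>"
    unfolding timelike_curve_def by blast
  then show ?thesis
    unfolding I_plus_def by (auto intro!: exI[of _ \<gamma>] simp: \<gamma>_def l_def)
qed

text \<open>The curve is the coordinate line through \<open>x\<close> in the direction of the time
  field. Since the future cones vary openly, its points are chronologically related together with
  whole neighbourhoods; the interior conditions on \<open>K_plus\<close> rest on this.\<close>

lemma local_timelike_curve:
  assumes "x \<in> events M"
  obtains e :: real and \<eta> where "e > 0" "\<eta> 0 = x" "continuous_map (top_of_set {-e..e}) (space_top M) \<eta>"
    "\<And>s t. -e \<le> s \<Longrightarrow> s < t \<Longrightarrow> t \<le> e \<Longrightarrow>
       \<exists>A B. openin (space_top M) A \<and> openin (space_top M) B \<and> \<eta> s \<in> A \<and> \<eta> t \<in> B \<and>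
             A \<times> B \<subseteq> I_plus M"
proof -
  obtain c where c: "c \<in> atlas M" "x \<in> chart_dom c"
    using assms spacetime
    unfolding events_def spacetime_def smooth_manifold_def smooth_atlas_def by blast
  note inv = is_chart_inv[OF atlas_is_chart[OF c(1)]]
  let ?z = "chart_map c x" and ?T = "time_field M c x"
  have "metric M c x ?T ?T < 0"
    using spacetime c unfolding spacetime_def time_orientation_def by blast
  then have "(?z, ?T) \<in> {(z, v). z \<in> chart_map c ` chart_dom c \<and>
      future_timelike M c (chart_inv c z) v}"
    using c(2) inv(1) by (simp add: future_timelike_def)
  then obtain P Q where PQ: "open P" "open Q" "(?z, ?T) \<in> P \<times> Q"
    "P \<times> Q \<subseteq> {(z, v). z \<in> chart_map c ` chart_dom c \<and> future_timelike M c (chart_inv c z) v}"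
    by (rule open_prod_elim[OF open_future_timelike[OF c(1)]])
  then have "?z \<in> P" "?T \<in> Q"
    by auto
  then obtain r1 r2 where "r1 > 0" "ball ?z r1 \<subseteq> P" "r2 > 0" "ball ?T r2 \<subseteq> Q"
    using openE[OF PQ(1)] openE[OF PQ(2)] by metis
  then have "\<exists>r>0. ball ?z r \<subseteq> P \<and> ball ?T r \<subseteq> Q"
    by (intro exI[of _ "min r1 r2"]) auto
  then obtain r where r: "r > 0" "ball ?z r \<subseteq> P" "ball ?T r \<subseteq> Q"
    by blast
  have dom: "z \<in> chart_map c ` chart_dom c" if "z \<in> ball ?z r" for z
    using that r \<open>?T \<in> Q\<close> PQ(4) by blast
  have fut: "future_timelike M c (chart_inv c z) v" if "z \<in> ball ?z r" "v \<in> ball ?T r" for z v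
    using that r PQ(4) by blast
  \<comment> \<open>The added 1 keeps the denominator positive and makes
    \<open>e * norm ?T < r\<close> strict, so that the line stays in the ball for all parameters up
    to \<open>e\<close> in absolute value.\<close>
  define e where "e = r / (norm ?T + 1)"
  have e: "e > 0" "e * norm ?T < r"
    using r(1) add_nonneg_pos[OF norm_ge_zero[of ?T] zero_less_one]
    by (auto simp: e_def divide_simps algebra_simps)
  define l where "l t = ?z + t *\<^sub>R ?T" for t
  have l_ball: "l t \<in> ball ?z r" if "t \<in> {-e..e}" for t
  proof -
    have "\<bar>t\<bar> * norm ?T \<le> e * norm ?T"
      using that by (intro mult_right_mono) auto
    then show ?thesis
      using e(2) by (simp add: l_def dist_norm)
  qed
  define \<eta> where "\<eta> = chart_inv c \<circ> l"
  have "continuous_on {-e..e} l"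
    unfolding l_def by (intro continuous_intros)
  then have "continuous_map (top_of_set {-e..e}) (top_of_set (chart_map c ` chart_dom c)) l"
    using dom l_ball by (auto simp: continuous_map_in_subtopology simp del: mem_ball)
  then have "continuous_map (top_of_set {-e..e}) (space_top M) \<eta>"
    unfolding \<eta>_def
    by (rule continuous_map_compose[OF _ continuous_map_chart_inv[OF atlas_is_chart[OF c(1)]]])
  moreover have "\<exists>A B. openin (space_top M) A \<and> openin (space_top M) B \<and> \<eta> s \<in> A \<and> \<eta> t \<in> B \<and>
             A \<times> B \<subseteq> I_plus M" if st: "-e \<le> s" "s < t" "t \<le> e" for s t
  proof -
    \<comment> \<open>Moving each end point by less than \<open>(t - s) * r / 2\<close> changes the
      mean velocity \<open>w\<close> by less than \<open>r\<close>, so it remains among the future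
      timelike vectors near \<open>?T\<close>.\<close>
    define U where "U u = {p \<in> chart_dom c. chart_map c p \<in> ball ?z r \<inter> ball (l u) ((t - s) * r / 2)}" for u
    have "openin (space_top M) (U u)" for u
      unfolding U_def
      by (intro openin_chart_vimage[OF atlas_is_chart[OF c(1)]] open_Int open_ball)
    moreover have "\<eta> u \<in> U u" if "u \<in> {s, t}" for u
    proof -
      have "l u \<in> ball ?z r"
        using that st by (intro l_ball) auto
      moreover have "l u \<in> ball (l u) ((t - s) * r / 2)"
        using st r(1) by simp
      moreover note inv(2,3)[OF dom[OF calculation(1)]]
      ultimately show ?thesis
        by (simp add: U_def \<eta>_def)
    qed
    moreover have "U s \<times> U t \<subseteq> I_plus M"
    proof clarify
      fix p q
      assume pq: "p \<in> U s" "q \<in> U t"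
      let ?a = "chart_map c p" and ?b = "chart_map c q"
      define w where "w = (1 / (t - s)) *\<^sub>R (?b - ?a)"
      have w: "?b - ?a = (t - s) *\<^sub>R w"
        using st by (simp add: w_def)
      have "(?b - l t) - (?a - l s) = (t - s) *\<^sub>R (w - ?T)"
        unfolding scaleR_right_diff_distrib w[symmetric] by (simp add: l_def algebra_simps)
      then have "(t - s) * norm (w - ?T) = norm ((?b - l t) - (?a - l s))"
        using st by simp
      also have "\<dots> \<le> norm (?b - l t) + norm (?a - l s)"
        by (rule norm_triangle_ineq4)
      also have "\<dots> < (t - s) * r / 2 + (t - s) * r / 2"
        using pq by (intro add_strict_mono) (simp_all add: U_def dist_norm norm_minus_commute)
      finally have "norm (w - ?T) < r"
        using st by simp
      then have w_ball: "w \<in> ball ?T r"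
        by (simp add: dist_norm norm_minus_commute)
      have seg: "?a + u *\<^sub>R (?b - ?a) \<in> ball ?z r" if "u \<in> {0..1}" for u
      proof -
        have "(1 - u) *\<^sub>R ?a + u *\<^sub>R ?b \<in> ball ?z r"
          using that pq convex_ball[of ?z r] by (intro convexD) (auto simp: U_def)
        then show ?thesis
          by (simp add: algebra_simps)
      qed
      have "(chart_inv c ?a, chart_inv c (?a + (?b - ?a))) \<in> I_plus M"
      proof (rule segment_chronological[OF c(1)])
        fix u :: real
        assume u: "u \<in> {0..1}"
        show "?a + u *\<^sub>R (?b - ?a) \<in> chart_map c ` chart_dom c"
          using dom[OF seg[OF u]] .
        then show "future_timelike M c (chart_inv c (?a + u *\<^sub>R (?b - ?a))) (?b - ?a)"
          using future_timelike_scaleR[OF c(1) inv(3) _ fut[OF seg[OF u] w_ball], of "t - s"] w st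
          by simp
      qed
      then show "(p, q) \<in> I_plus M"
        using pq inv(1) by (simp add: U_def)
    qed
    ultimately show ?thesis
      by (intro exI[of _ "U s"] exI[of _ "U t"]) auto
  qed
  moreover have "\<eta> 0 = x"
    using inv(1) c(2) by (simp add: \<eta>_def l_def)
  ultimately show thesis
    by (intro that[OF e(1)])
qed

section \<open>The order axioms for \<open>K_plus\<close>\<close>

lemma I_plus_subset_K_plus: "I_plus M \<subseteq> K_plus M"
  unfolding K_plus_def by blast

lemma I_plus_subset_events: "I_plus M \<subseteq> events M \<times> events M"
proof clarify
  fix p q
  assume "(p, q) \<in> I_plus M"
  then obtain \<gamma> where \<gamma>: "timelike_curve M \<gamma>" "\<gamma> 0 = p" "\<gamma> 1 = q"
    unfolding I_plus_def by blast
  then have "continuous_map (top_of_set {0..1}) (space_top M) \<gamma>"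
    by (simp add: timelike_curve_def)
  then have "\<gamma> ` {0..1} \<subseteq> events M"
    using continuous_map_image_subset_topspace unfolding events_def by fastforce
  then show "p \<in> events M \<and> q \<in> events M"
    using \<gamma>(2,3) by auto
qed

lemma closedin_K_plus: "closedin (prod_topology (space_top M) (space_top M)) (K_plus M)"
proof -
  \<comment> \<open>An intersection of closed sets is closed provided the family is nonempty; the
    full relation on events is a member.\<close>
  have "events M \<times> events M \<in> {R. I_plus M \<subseteq> R \<and> trans R \<and>
      closedin (prod_topology (space_top M) (space_top M)) R}"
    using I_plus_subset_events closedin_topspace[of "prod_topology (space_top M) (space_top M)"]
    by (auto simp: trans_def events_def)
  then show ?thesis
    unfolding K_plus_def by (intro closedin_Inter) auto
qed

text \<open>Run along the local timelike curve through \<open>x\<close> towards parameter 0 from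
  both sides. This supplies \<open>approx_below\<close> and \<open>approx_above\<close>.\<close>

lemma chronological_approximation:
  assumes "x \<in> events M"
  shows "\<exists>y z. limitin (space_top M) y x sequentially \<and> limitin (space_top M) z x sequentially \<and>
    (\<forall>n. (y n, y (Suc n)) \<in> K_plus M \<and> x \<in> space_top M interior_of (K_plus M `` {y n})) \<and>
    (\<forall>n. (z (Suc n), z n) \<in> K_plus M \<and> x \<in> space_top M interior_of ((K_plus M)\<inverse> `` {z n}))"
proof -
  obtain e :: real and \<eta> where e: "e > 0" and \<eta>0: "\<eta> 0 = x"
    and \<eta>: "continuous_map (top_of_set {-e..e}) (space_top M) \<eta>"
    and chron: "\<And>s t. -e \<le> s \<Longrightarrow> s < t \<Longrightarrow> t \<le> e \<Longrightarrow>
       \<exists>A B. openin (space_top M) A \<and> openin (space_top M) B \<and> \<eta> s \<in> A \<and> \<eta> t \<in> B \<and>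
             A \<times> B \<subseteq> I_plus M"
    by (rule local_timelike_curve[OF assms], rule that) blast+
  define s where "s n = e / real (Suc n)" for n
  have s: "0 < s n" "s n \<le> e" "s (Suc n) < s n" for n
    using e by (auto simp: s_def divide_simps)
  have s0: "s \<longlonglongrightarrow> 0"
    unfolding s_def by (rule LIMSEQ_Suc[OF lim_const_over_n])
  have lim: "limitin (space_top M) (\<lambda>n. \<eta> (t n)) x sequentially"
    if "t \<longlonglongrightarrow> 0" "\<And>n. t n \<in> {-e..e}" for t
  proof -
    have "limitin (top_of_set {-e..e}) t 0 sequentially"
      using that e by (simp add: limitin_subtopology)
    from continuous_map_limit[OF \<eta> this] show ?thesis
      by (simp add: o_def \<eta>0)
  qed
  have "limitin (space_top M) (\<lambda>n. \<eta> (- s n)) x sequentially"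
  proof (rule lim)
    show "- s n \<in> {-e..e}" for n
      using s[of n] e by auto
  qed (use tendsto_minus[OF s0] in simp)
  moreover have "limitin (space_top M) (\<lambda>n. \<eta> (s n)) x sequentially"
  proof (rule lim[OF s0])
    show "s n \<in> {-e..e}" for n
      using s[of n] e by auto
  qed
  moreover have K: "(\<eta> a, \<eta> b) \<in> K_plus M" and
    fut: "\<eta> b \<in> space_top M interior_of (K_plus M `` {\<eta> a})" and
    past: "\<eta> a \<in> space_top M interior_of ((K_plus M)\<inverse> `` {\<eta> b})"
    if ab: "-e \<le> a" "a < b" "b \<le> e" for a b
  proof -
    obtain A B where AB: "openin (space_top M) A" "openin (space_top M) B" "\<eta> a \<in> A" "\<eta> b \<in> B"
             "A \<times> B \<subseteq> K_plus M"
      using chron[OF ab] I_plus_subset_K_plus by blast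
    show "(\<eta> a, \<eta> b) \<in> K_plus M"
      using AB by blast
    have "B \<subseteq> K_plus M `` {\<eta> a}" "A \<subseteq> (K_plus M)\<inverse> `` {\<eta> b}"
      using AB by auto
    then show "\<eta> b \<in> space_top M interior_of (K_plus M `` {\<eta> a})"
      "\<eta> a \<in> space_top M interior_of ((K_plus M)\<inverse> `` {\<eta> b})"
      using AB interior_of_maximal by (metis subsetD)+
  qed
  moreover have "(\<eta> (- s n), \<eta> (- s (Suc n))) \<in> K_plus M" "(\<eta> (s (Suc n)), \<eta> (s n)) \<in> K_plus M" for n
    using s[of n] s[of "Suc n"] e by (auto intro!: K)
  moreover have "x \<in> space_top M interior_of (K_plus M `` {\<eta> (- s n)})"
    "x \<in> space_top M interior_of ((K_plus M)\<inverse> `` {\<eta> (s n)})" for n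
    using fut[of "- s n" 0] past[of 0 "s n"] s[of n] e by (simp_all add: \<eta>0)
  ultimately show ?thesis
    by (intro exI[of _ "\<lambda>n. \<eta> (- s n)"] exI[of _ "\<lambda>n. \<eta> (s n)"]) simp
qed

text \<open>The connected set is the image of a timelike curve. Its subarcs are chronological, and
  reflexivity of \<open>K_plus\<close> covers the end points themselves.\<close>

lemma chronological_connected_chain:
  assumes refl: "\<And>p. p \<in> events M \<Longrightarrow> (p, p) \<in> K_plus M" and "(p, q) \<in> I_plus M"
  shows "\<exists>S. connectedin (space_top M) S \<and> p \<in> S \<and> q \<in> S \<and>
    (\<forall>w\<in>S. (p, w) \<in> K_plus M \<and> (w, q) \<in> K_plus M)"
proof -
  obtain \<gamma> where \<gamma>: "timelike_curve M \<gamma>" "\<gamma> 0 = p" "\<gamma> 1 = q"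
    using assms(2) unfolding I_plus_def by blast
  have "connectedin (space_top M) (\<gamma> ` {0..1})"
    using \<gamma>(1) unfolding timelike_curve_def
    by (intro connectedin_continuous_map_image[of "top_of_set {0..1}"])
      (auto simp: connectedin_subtopology)
  moreover have "(\<gamma> s, \<gamma> t) \<in> K_plus M" if "0 \<le> s" "s \<le> t" "t \<le> 1" for s t
  proof (cases "s = t")
    case True
    have "\<gamma> s \<in> events M"
      using connectedin_subset_topspace[OF calculation] that unfolding events_def by auto
    then show ?thesis
      using True refl by simp
  next
    case False
    then show ?thesis
      using timelike_curve_chronological[OF \<gamma>(1), of s t] that I_plus_subset_K_plus by auto
  qed
  ultimately show ?thesis
    using \<gamma>(2,3) by (intro exI[of _ "\<gamma> ` {0..1}"]) force
qed

lemma closed_interpolating_order_K_plus: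
  assumes "K_causal M"
  shows "closed_interpolating_order (space_top M) (K_plus M)"
proof
  show order: "partial_order_on (topspace (space_top M)) (K_plus M)"
    using assms by (simp add: K_causal_def events_def)
  show "Hausdorff_space (space_top M)" "locally_compact_space (space_top M)"
    using spacetime locally_compact_smooth_atlas by (auto simp: spacetime_def smooth_manifold_def)
  have refl: "(p, p) \<in> K_plus M" if "p \<in> events M" for p
    using order that by (auto simp: order_on_defs refl_on_def events_def)
  show "\<exists>w\<in>C \<inter> D. (a, w) \<in> K_plus M \<and> (w, b) \<in> K_plus M"
    if "(a, b) \<in> K_plus M" "closedin (space_top M) C" "closedin (space_top M) D"
      "C \<union> D = topspace (space_top M)" "compactin (space_top M) (C \<inter> D)" "a \<notin> C" "b \<notin> D" for a b C D
    using closed_transitive_hull_interpolation[OF K_plus_def closedin_K_plus chronological_connected_chain] that refl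
    by blast
qed (use closedin_K_plus chronological_approximation in \<open>unfold events_def, blast+\<close>)

end

theorem theorem3p5:
  fixes M :: "('a, 'e::euclidean_space) spacetime_data"
  assumes "spacetime M" and "K_causal M"
  shows "(\<forall>p\<in>events M. \<forall>q\<in>events M. openin (space_top M) (A_set M p q)) \<and>
         (\<forall>W. openin (space_top M) W \<longrightarrow>
            (\<exists>\<U>. \<U> \<subseteq> {A_set M p q | p q. p \<in> events M \<and> q \<in> events M} \<and> \<Union>\<U> = W))"
proof -
  interpret closed_interpolating_order "space_top M" "K_plus M"
    using closed_interpolating_order_K_plus assms by blast
  have fut: "K_fut M p = K_plus M `` {p}" for p
    using K_subset by (auto simp: K_fut_def events_def)
  have past: "K_past M q = (K_plus M)\<inverse> `` {q}" for q
    using K_subset by (auto simp: K_past_def events_def)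
  have "bd_K_fut M p = future_bd (events M) (K_plus M) p" for p
    by (simp add: bd_K_fut_def future_bd_def fut)
  moreover have "bd_K_past M q = future_bd (events M) ((K_plus M)\<inverse>) q" for q
    by (simp add: bd_K_past_def future_bd_def past is_infimum_def is_supremum_def)
  \<comment> \<open>Removing the order-theoretic boundaries leaves the interiors, so
    \<open>A_set M p q\<close> is an intersection of two open sets.\<close>
  ultimately have A: "A_set M p q = space_top M interior_of (K_plus M `` {p}) \<inter>
      space_top M interior_of ((K_plus M)\<inverse> `` {q})" for p q
    using future_diff_bd[of p] past_diff_bd[of q]
    by (simp add: A_set_def A_fut_def A_past_def fut past events_def)
  have "\<exists>\<U>. \<U> \<subseteq> {A_set M p q | p q. p \<in> events M \<and> q \<in> events M} \<and> \<Union>\<U> = W"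
    if W: "openin (space_top M) W" for W
  proof (intro exI[of _ "{A_set M p q | p q. p \<in> events M \<and> q \<in> events M \<and> A_set M p q \<subseteq> W}"]
      conjI equalityI subsetI)
    fix x
    assume "x \<in> W"
    with W obtain p q where "p \<in> events M" "q \<in> events M" "x \<in> A_set M p q"
      "K_plus M `` {p} \<inter> (K_plus M)\<inverse> `` {q} \<subseteq> W"
      using interval_neighbourhood unfolding A events_def by metis
    moreover have "A_set M p q \<subseteq> K_plus M `` {p} \<inter> (K_plus M)\<inverse> `` {q}"
      unfolding A using interior_of_subset by (metis Int_mono)
    ultimately show "x \<in> \<Union>{A_set M p q | p q. p \<in> events M \<and> q \<in> events M \<and> A_set M p q \<subseteq> W}"
      by blast
  qed blast+
  then show ?thesis
    unfolding A by (simp add: openin_Int)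
qed

end
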